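(* An $n$-strand braid $\beta$ is order-preserving if and only if there is a positive cone $P$ of $F_n$ with $\beta(P)=P$ such that every word in $F_n$ with positive exponent sum belongs to $P$.
   Context: $F_n=\langle x_1,\dots,x_n\rangle$ is the free group of rank $n$, and $B_n$ is the $n$-strand braid group with Artin generators $\sigma_1,\dots,\sigma_{n-1}$. $B_n$ acts on $F_n$ on the left by automorphisms (braid words are read from right to left, so a product of braids acts as the composition of the corresponding automorphisms, rightmost first), where $\sigma_i$ acts by $x_i\mapsto x_{i+1}$, $x_{i+1}\mapsto x_{i+1}^{-1}x_ix_{i+1}$, and $x_j\mapsto x_j$ for $j\neq i,i+1$. We write $\beta(\cdot)$ for the action of $\beta$ on elements and subsets of $F_n$. A subset $P\subset F_n$ is a (conjugation-invariant) positive cone if (1) $P\cdot P\subset P$; (2) $F_n=P\sqcup P^{-1}\sqcup\{1\}$ (disjoint union); (3) $gPg^{-1}=P$ for all $g\in F_n$. A braid $\beta\in B_n$ is order-preserving if there is a positive cone $P$ of $F_n$ preserved by $\beta$, i.e. with $\beta(P)=P$. The exponent sum of an element of $F_n$ is its image under the homomorphism $t:F_n\to\mathbb{Z}$ with $t(x_i)=1$ for all $i$. *)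

theory Defs
  imports "HOL-Algebra.Bij" "HOL-Algebra.Coset" "HOL-Algebra.Elementary_Groups"
begin

section \<open>Groups given by generators and relations\<close>

text \<open>A word over the generators \<open>S\<close> is a list of signed letters: \<open>(a, True)\<close> stands for the
  generator \<open>a\<close> and \<open>(a, False)\<close> for its inverse. A relation \<open>r = s\<close> is the pair \<open>(r, s)\<close>.\<close>

type_synonym 'a word = "('a \<times> bool) list"

abbreviation words :: "'a set \<Rightarrow> 'a word set" where
  "words S \<equiv> lists (S \<times> UNIV)"

inductive_set word_rel :: "'a set \<Rightarrow> ('a word \<times> 'a word) set \<Rightarrow> ('a word \<times> 'a word) set"
  for S :: "'a set" and R :: "('a word \<times> 'a word) set" where
  refl: "w \<in> words S \<Longrightarrow> (w, w) \<in> word_rel S R"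
| sym: "(v, w) \<in> word_rel S R \<Longrightarrow> (w, v) \<in> word_rel S R"
| trans: "(u, v) \<in> word_rel S R \<Longrightarrow> (v, w) \<in> word_rel S R \<Longrightarrow> (u, w) \<in> word_rel S R"
| cancel: "u \<in> words S \<Longrightarrow> v \<in> words S \<Longrightarrow> a \<in> S \<Longrightarrow>
    (u @ [(a, e), (a, \<not> e)] @ v, u @ v) \<in> word_rel S R"
| relation: "u \<in> words S \<Longrightarrow> v \<in> words S \<Longrightarrow> (r, s) \<in> R \<Longrightarrow> r \<in> words S \<Longrightarrow> s \<in> words S \<Longrightarrow>
    (u @ r @ v, u @ s @ v) \<in> word_rel S R"

definition word_class :: "'a set \<Rightarrow> ('a word \<times> 'a word) set \<Rightarrow> 'a word \<Rightarrow> 'a word set" where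
  "word_class S R w = word_rel S R `` {w}"

definition presented_group :: "'a set \<Rightarrow> ('a word \<times> 'a word) set \<Rightarrow> 'a word set monoid" where
  "presented_group S R =
    \<lparr>carrier = words S // word_rel S R,
     mult = (\<lambda>X Y. \<Union>x\<in>X. \<Union>y\<in>Y. word_class S R (x @ y)),
     one = word_class S R []\<rparr>"

text \<open>The homomorphism out of a presented group determined by the images \<open>f\<close> of the generators
  (meaningful when \<open>f\<close> respects the relations, see \<open>gen_lift_hom\<close> below).\<close>

primrec word_eval :: "('b, 'c) monoid_scheme \<Rightarrow> ('a \<Rightarrow> 'b) \<Rightarrow> 'a word \<Rightarrow> 'b" where
  "word_eval G f [] = \<one>\<^bsub>G\<^esub>"
| "word_eval G f (l # w) =
    (if snd l then f (fst l) else inv\<^bsub>G\<^esub> f (fst l)) \<otimes>\<^bsub>G\<^esub> word_eval G f w"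

definition gen_lift :: "('b, 'c) monoid_scheme \<Rightarrow> ('a \<Rightarrow> 'b) \<Rightarrow> 'a word set \<Rightarrow> 'b" where
  "gen_lift G f X = the_elem (word_eval G f ` X)"


section \<open>The free group, the braid group and its action\<close>

definition free_group :: "nat \<Rightarrow> nat word set monoid" where
  "free_group n = presented_group {1..n} {}"

definition free_gen :: "nat \<Rightarrow> nat \<Rightarrow> nat word set" where
  "free_gen n i = word_class {1..n} {} [(i, True)]"

definition exponent_sum :: "nat word set \<Rightarrow> int" where
  "exponent_sum = gen_lift integer_group (\<lambda>i. 1)"

definition braid_relations :: "nat \<Rightarrow> (nat word \<times> nat word) set" where
  "braid_relations n =
    {([(i, True), (j, True)], [(j, True), (i, True)]) | i j.
       i \<in> {1..<n} \<and> j \<in> {1..<n} \<and> i + 2 \<le> j} \<union>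
    {([(i, True), (Suc i, True), (i, True)], [(Suc i, True), (i, True), (Suc i, True)]) | i.
       i \<in> {1..<n} \<and> Suc i \<in> {1..<n}}"

definition braid_group :: "nat \<Rightarrow> nat word set monoid" where
  "braid_group n = presented_group {1..<n} (braid_relations n)"

definition braid_gen :: "nat \<Rightarrow> nat \<Rightarrow> nat word set" where
  "braid_gen n i = word_class {1..<n} (braid_relations n) [(i, True)]"

definition artin_image :: "nat \<Rightarrow> nat \<Rightarrow> nat \<Rightarrow> nat word set" where
  "artin_image n i j =
    (if j = i then free_gen n (Suc i)
     else if j = Suc i then
       inv\<^bsub>free_group n\<^esub> free_gen n (Suc i) \<otimes>\<^bsub>free_group n\<^esub> free_gen n i
         \<otimes>\<^bsub>free_group n\<^esub> free_gen n (Suc i)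
     else free_gen n j)"

text \<open>Members of \<^const>\<open>AutoGroup\<close> are extensional, hence the restriction. The product
  of \<open>g\<close> and \<open>f\<close> in \<^const>\<open>AutoGroup\<close> is the composition applying \<open>f\<close> first, so a braid word acts from
  right to left.\<close>

definition artin_auto :: "nat \<Rightarrow> nat \<Rightarrow> nat word set \<Rightarrow> nat word set" where
  "artin_auto n i = restrict (gen_lift (free_group n) (artin_image n i)) (carrier (free_group n))"

definition braid_action :: "nat \<Rightarrow> nat word set \<Rightarrow> nat word set \<Rightarrow> nat word set" where
  "braid_action n = gen_lift (AutoGroup (free_group n)) (artin_auto n)"


section \<open>Positive cones and order-preserving braids\<close>

definition positive_cone :: "('a, 'b) monoid_scheme \<Rightarrow> 'a set \<Rightarrow> bool" where
  "positive_cone G P \<longleftrightarrow>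
     P \<subseteq> carrier G \<and>
     P <#>\<^bsub>G\<^esub> P \<subseteq> P \<and>
     carrier G = P \<union> set_inv\<^bsub>G\<^esub> P \<union> {\<one>\<^bsub>G\<^esub>} \<and>
     P \<inter> set_inv\<^bsub>G\<^esub> P = {} \<and> \<one>\<^bsub>G\<^esub> \<notin> P \<and> \<one>\<^bsub>G\<^esub> \<notin> set_inv\<^bsub>G\<^esub> P \<and>
     (\<forall>g\<in>carrier G. (g <#\<^bsub>G\<^esub> P) #>\<^bsub>G\<^esub> inv\<^bsub>G\<^esub> g = P)"

definition order_preserving :: "nat \<Rightarrow> nat word set \<Rightarrow> bool" where
  "order_preserving n \<beta> \<longleftrightarrow> (\<exists>P. positive_cone (free_group n) P \<and> braid_action n \<beta> ` P = P)"


section \<open>Well-definedness\<close>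

lemma word_rel_words: "(v, w) \<in> word_rel S R \<Longrightarrow> v \<in> words S \<and> w \<in> words S"
  by (induction rule: word_rel.induct) auto

lemma equiv_word_rel: "equiv (words S) (word_rel S R)"
proof (rule equivI)
  show "word_rel S R \<subseteq> words S \<times> words S"
    using word_rel_words by fastforce
  show "refl_on (words S) (word_rel S R)"
    by (rule refl_onI) (auto intro: word_rel.refl)
  show "sym (word_rel S R)"
    by (rule symI) (rule word_rel.sym)
  show "trans (word_rel S R)"
    by (rule transI) (rule word_rel.trans)
qed

lemma word_class_eq_iff:
  assumes "v \<in> words S" "w \<in> words S"
  shows "word_class S R v = word_class S R w \<longleftrightarrow> (v, w) \<in> word_rel S R"
  unfolding word_class_def using eq_equiv_class_iff[OF equiv_word_rel assms] .

lemma word_rel_context: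
  assumes "(v, w) \<in> word_rel S R" "a \<in> words S" "b \<in> words S"
  shows "(a @ v @ b, a @ w @ b) \<in> word_rel S R"
  using assms(1)
proof (induction rule: word_rel.induct)
  case (refl w)
  then show ?case using assms by (intro word_rel.refl) auto
next
  case (sym v w)
  then show ?case by (blast intro: word_rel.sym)
next
  case (trans u v w)
  then show ?case by (blast intro: word_rel.trans)
next
  case (cancel u v c e)
  then show ?case using assms word_rel.cancel[of "a @ u" S "v @ b" c e R] by auto
next
  case (relation u v r s)
  then show ?case using assms word_rel.relation[of "a @ u" S "v @ b" r s R] by auto
qed

lemma word_rel_append:
  assumes "(v, v') \<in> word_rel S R" "(w, w') \<in> word_rel S R"
  shows "(v @ w, v' @ w') \<in> word_rel S R"
proof (rule word_rel.trans)
  show "(v @ w, v' @ w) \<in> word_rel S R"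
    using word_rel_context[OF assms(1), of "[]" w] word_rel_words[OF assms(2)] by simp
  show "(v' @ w, v' @ w') \<in> word_rel S R"
    using word_rel_context[OF assms(2), of v' "[]"] word_rel_words[OF assms(1)] by simp
qed

lemma word_class_in_carrier:
  "w \<in> words S \<Longrightarrow> word_class S R w \<in> carrier (presented_group S R)"
  by (simp add: presented_group_def word_class_def quotientI)

lemma presented_group_cases:
  assumes "X \<in> carrier (presented_group S R)"
  obtains w where "w \<in> words S" "X = word_class S R w"
  using assms unfolding presented_group_def word_class_def
  by (metis partial_object.select_convs(1) quotientE)

lemma word_class_mult:
  assumes "v \<in> words S" "w \<in> words S"
  shows "word_class S R v \<otimes>\<^bsub>presented_group S R\<^esub> word_class S R w = word_class S R (v @ w)"
proof -
  have "word_class S R (x @ y) = word_class S R (v @ w)"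
    if "x \<in> word_class S R v" "y \<in> word_class S R w" for x y
  proof -
    have r: "(v, x) \<in> word_rel S R" "(w, y) \<in> word_rel S R"
      using that by (auto simp: word_class_def)
    have "(x @ y, v @ w) \<in> word_rel S R"
      by (rule word_rel.sym[OF word_rel_append[OF r]])
    then show ?thesis
      using word_rel_words[of "x @ y" "v @ w" S R] by (simp add: word_class_eq_iff del: append_in_lists_conv)
  qed
  moreover have "v \<in> word_class S R v" "w \<in> word_class S R w"
    using assms by (auto simp: word_class_def intro: word_rel.refl)
  ultimately have "(\<Union>x\<in>word_class S R v. \<Union>y\<in>word_class S R w. word_class S R (x @ y)) =
      word_class S R (v @ w)"
    by blast
  then show ?thesis by (simp add: presented_group_def)
qed

lemma word_class_one: "\<one>\<^bsub>presented_group S R\<^esub> = word_class S R []"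
  by (simp add: presented_group_def)

definition inv_word :: "'a word \<Rightarrow> 'a word" where
  "inv_word w = rev (map (\<lambda>(a, e). (a, \<not> e)) w)"

lemma inv_word_words: "w \<in> words S \<Longrightarrow> inv_word w \<in> words S"
  by (auto simp: inv_word_def)

lemma inv_word_cancel:
  assumes "w \<in> words S"
  shows "(inv_word w @ w, []) \<in> word_rel S R"
  using assms
proof (induction w)
  case Nil
  then show ?case by (simp add: inv_word_def word_rel.refl)
next
  case (Cons l w)
  obtain a e where l: "l = (a, e)" by force
  have "(inv_word w @ [(a, \<not> e), (a, \<not> \<not> e)] @ w, inv_word w @ w) \<in> word_rel S R"
    using Cons.hyps l by (intro word_rel.cancel inv_word_words) auto
  then have "(inv_word (l # w) @ l # w, inv_word w @ w) \<in> word_rel S R"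
    by (simp add: inv_word_def l)
  then show ?case
    using Cons by (auto intro: word_rel.trans)
qed

lemma group_presented_group: "group (presented_group S R)"
proof (rule groupI)
  fix X Y Z
  assume X: "X \<in> carrier (presented_group S R)"
  then obtain v where v: "v \<in> words S" "X = word_class S R v" by (rule presented_group_cases)
  show "\<one>\<^bsub>presented_group S R\<^esub> \<otimes>\<^bsub>presented_group S R\<^esub> X = X"
    using v by (simp add: word_class_one word_class_mult)
  have "word_class S R (inv_word v) \<otimes>\<^bsub>presented_group S R\<^esub> X = \<one>\<^bsub>presented_group S R\<^esub>"
    using v inv_word_words[of v S] inv_word_cancel[of v S R]
    by (simp add: word_class_one word_class_mult word_class_eq_iff)
  then show "\<exists>Y\<in>carrier (presented_group S R). Y \<otimes>\<^bsub>presented_group S R\<^esub> X = \<one>\<^bsub>presented_group S R\<^esub>"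
    by (rule bexI) (intro word_class_in_carrier inv_word_words v(1))
  assume "Y \<in> carrier (presented_group S R)"
  then obtain w where w: "w \<in> words S" "Y = word_class S R w" by (rule presented_group_cases)
  show "X \<otimes>\<^bsub>presented_group S R\<^esub> Y \<in> carrier (presented_group S R)"
    using v w by (simp add: word_class_mult word_class_in_carrier)
  assume "Z \<in> carrier (presented_group S R)"
  then obtain u where u: "u \<in> words S" "Z = word_class S R u" by (rule presented_group_cases)
  show "X \<otimes>\<^bsub>presented_group S R\<^esub> Y \<otimes>\<^bsub>presented_group S R\<^esub> Z =
        X \<otimes>\<^bsub>presented_group S R\<^esub> (Y \<otimes>\<^bsub>presented_group S R\<^esub> Z)"
    using u v w by (simp add: word_class_mult)
next
  show "\<one>\<^bsub>presented_group S R\<^esub> \<in> carrier (presented_group S R)"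
    by (simp add: word_class_one word_class_in_carrier)
qed

lemma (in group) word_eval_closed:
  assumes "f \<in> S \<rightarrow> carrier G" "w \<in> words S"
  shows "word_eval G f w \<in> carrier G"
  using assms(2) assms(1) by (induction w) (auto simp: Pi_iff)

lemma (in group) word_eval_append:
  assumes "f \<in> S \<rightarrow> carrier G" "v \<in> words S" "w \<in> words S"
  shows "word_eval G f (v @ w) = word_eval G f v \<otimes> word_eval G f w"
  using assms(2)
proof (induction v)
  case Nil
  then show ?case using word_eval_closed[OF assms(1,3)] by simp
next
  case (Cons l v)
  have "f (fst l) \<in> carrier G" using Cons assms(1) by auto
  moreover have "word_eval G f v \<in> carrier G" "word_eval G f w \<in> carrier G"
    using word_eval_closed[OF assms(1)] Cons assms(3) by blast+
  ultimately show ?case using Cons by (simp add: m_assoc)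
qed

lemma (in group) word_eval_cong_rel:
  assumes f: "f \<in> S \<rightarrow> carrier G"
    and R: "\<forall>(r, s)\<in>R. word_eval G f r = word_eval G f s"
    and "(v, w) \<in> word_rel S R"
  shows "word_eval G f v = word_eval G f w"
  using assms(3)
proof (induction rule: word_rel.induct)
  case (cancel u v a e)
  have p: "[(a, e), (a, \<not> e)] \<in> words S" and "f a \<in> carrier G"
    using cancel f by auto
  then have "word_eval G f [(a, e), (a, \<not> e)] = \<one>"
    by (cases e) simp_all
  then show ?case
    unfolding word_eval_append[OF f cancel(1,2)]
    using cancel p word_eval_closed[OF f]
    by (simp only: word_eval_append[OF f] append_in_lists_conv l_one)
next
  case (relation u v r s)
  then have "word_eval G f r = word_eval G f s" using R by blast
  then show ?case
    using relation by (simp only: word_eval_append[OF f] append_in_lists_conv)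
qed auto

lemma (in group) gen_lift_word_class:
  assumes f: "f \<in> S \<rightarrow> carrier G"
    and R: "\<forall>(r, s)\<in>R. word_eval G f r = word_eval G f s"
    and w: "w \<in> words S"
  shows "gen_lift G f (word_class S R w) = word_eval G f w"
proof -
  have "w \<in> word_class S R w" using w by (simp add: word_class_def word_rel.refl)
  moreover have "word_eval G f x = word_eval G f w" if "x \<in> word_class S R w" for x
    by (rule word_eval_cong_rel[OF f R, symmetric]) (use that in \<open>simp add: word_class_def\<close>)
  ultimately have "word_eval G f ` word_class S R w = {word_eval G f w}"
    by blast
  then show ?thesis by (simp add: gen_lift_def)
qed

lemma (in group) gen_lift_gen:
  assumes f: "f \<in> S \<rightarrow> carrier G"
    and R: "\<forall>(r, s)\<in>R. word_eval G f r = word_eval G f s"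
    and a: "a \<in> S"
  shows "gen_lift G f (word_class S R [(a, True)]) = f a"
  using gen_lift_word_class[OF f R, of "[(a, True)]"] a funcset_mem[OF f a] by simp

lemma (in group) gen_lift_hom:
  assumes f: "f \<in> S \<rightarrow> carrier G"
    and R: "\<forall>(r, s)\<in>R. word_eval G f r = word_eval G f s"
  shows "gen_lift G f \<in> hom (presented_group S R) G"
proof (rule homI)
  fix X assume "X \<in> carrier (presented_group S R)"
  then obtain v where v: "v \<in> words S" "X = word_class S R v" by (rule presented_group_cases)
  show "gen_lift G f X \<in> carrier G"
    using v gen_lift_word_class[OF f R] word_eval_closed[OF f] by simp
  fix Y assume "Y \<in> carrier (presented_group S R)"
  then obtain w where w: "w \<in> words S" "Y = word_class S R w" by (rule presented_group_cases)
  show "gen_lift G f (X \<otimes>\<^bsub>presented_group S R\<^esub> Y) = gen_lift G f X \<otimes> gen_lift G f Y"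
    using v w gen_lift_word_class[OF f R] word_eval_append[OF f] by (simp add: word_class_mult)
qed

lemma hom_eq_on_gens:
  assumes G: "group G" and h: "h \<in> hom (presented_group S R) G" and k: "k \<in> hom (presented_group S R) G"
    and eq: "\<And>a. a \<in> S \<Longrightarrow> h (word_class S R [(a, True)]) = k (word_class S R [(a, True)])"
    and X: "X \<in> carrier (presented_group S R)"
  shows "h X = k X"
proof -
  let ?F = "presented_group S R"
  interpret h: group_hom ?F G h
    using G h group_presented_group by (simp add: group_hom_def group_hom_axioms_def)
  interpret k: group_hom ?F G k
    using G k group_presented_group by (simp add: group_hom_def group_hom_axioms_def)
  have letter: "h (word_class S R [(a, e)]) = k (word_class S R [(a, e)])" if "a \<in> S" for a e
  proof (cases e)
    case False
    have "word_class S R [(a, False)] \<otimes>\<^bsub>?F\<^esub> word_class S R [(a, True)] = \<one>\<^bsub>?F\<^esub>"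
      using that word_rel.cancel[of "[]" S "[]" a False R]
      by (simp add: word_class_mult word_class_one word_class_eq_iff)
    then have "word_class S R [(a, False)] = inv\<^bsub>?F\<^esub> word_class S R [(a, True)]"
      using that by (intro h.G.inv_equality[symmetric] word_class_in_carrier) auto
    then show ?thesis
      using that eq[OF that] False word_class_in_carrier[of "[(a, True)]" S R] by simp
  qed (use eq that in simp)
  have "h (word_class S R w) = k (word_class S R w)" if "w \<in> words S" for w
    using that
  proof (induction w)
    case Nil
    then show ?case using h.hom_one k.hom_one by (simp add: word_class_one)
  next
    case (Cons l w)
    obtain a e where l: "l = (a, e)" by force
    have "word_class S R (l # w) = word_class S R [(a, e)] \<otimes>\<^bsub>?F\<^esub> word_class S R w"
      using Cons l by (simp add: word_class_mult)
    moreover have "word_class S R [(a, e)] \<in> carrier ?F" "word_class S R w \<in> carrier ?F"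
      using Cons l by (auto intro!: word_class_in_carrier)
    ultimately show ?case
      using Cons l letter[of a e] by simp
  qed
  then show ?thesis
    using X by (metis presented_group_cases)
qed

lemma group_free_group: "group (free_group n)"
  unfolding free_group_def by (rule group_presented_group)

lemma group_braid_group: "group (braid_group n)"
  unfolding braid_group_def by (rule group_presented_group)

lemma free_gen_closed: "i \<in> {1..n} \<Longrightarrow> free_gen n i \<in> carrier (free_group n)"
  unfolding free_group_def free_gen_def by (rule word_class_in_carrier) auto

lemma exponent_sum_hom: "exponent_sum \<in> hom (free_group n) integer_group"
  unfolding exponent_sum_def free_group_def
  by (rule group.gen_lift_hom) auto

lemma exponent_sum_free_gen: "i \<in> {1..n} \<Longrightarrow> exponent_sum (free_gen n i) = 1"
  unfolding exponent_sum_def free_gen_def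
  by (rule group.gen_lift_gen) auto

lemma artin_image_closed:
  assumes "i \<in> {1..<n}"
  shows "artin_image n i \<in> {1..n} \<rightarrow> carrier (free_group n)"
proof -
  interpret group "free_group n" by (rule group_free_group)
  show ?thesis
    using assms by (auto simp: artin_image_def intro!: free_gen_closed m_closed inv_closed)
qed

lemma artin_auto_hom:
  assumes "i \<in> {1..<n}"
  shows "artin_auto n i \<in> hom (free_group n) (free_group n)"
proof -
  interpret group "free_group n" by (rule group_free_group)
  have "gen_lift (free_group n) (artin_image n i) \<in> hom (free_group n) (free_group n)"
    using gen_lift_hom[OF artin_image_closed[OF assms], of "{}"] by (simp add: free_group_def)
  then show ?thesis
    by (auto simp: artin_auto_def hom_def Pi_iff)
qed

lemma artin_auto_free_gen:
  assumes "i \<in> {1..<n}" "j \<in> {1..n}"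
  shows "artin_auto n i (free_gen n j) = artin_image n i j"
proof -
  interpret group "free_group n" by (rule group_free_group)
  have "gen_lift (free_group n) (artin_image n i) (free_gen n j) = artin_image n i j"
    unfolding free_gen_def by (rule gen_lift_gen[OF artin_image_closed]) (use assms in auto)
  then show ?thesis using assms by (simp add: artin_auto_def free_gen_closed)
qed

lemma free_group_hom_eq:
  assumes "h \<in> hom (free_group n) (free_group n)" "k \<in> hom (free_group n) (free_group n)"
    and "\<And>j. j \<in> {1..n} \<Longrightarrow> h (free_gen n j) = k (free_gen n j)"
    and "X \<in> carrier (free_group n)"
  shows "h X = k X"
  using assms hom_eq_on_gens[OF group_free_group[of n], of h "{1..n}" "{}" k X]
  by (simp add: free_group_def free_gen_def)

lemma (in group) inv_cancel_left:
  assumes "x \<in> carrier G" "y \<in> carrier G"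
  shows "x \<otimes> (inv x \<otimes> y) = y" and "inv x \<otimes> (x \<otimes> y) = y"
  using assms by (simp_all add: m_assoc[symmetric])

lemma artin_auto_in_auto:
  assumes i: "i \<in> {1..<n}"
  shows "artin_auto n i \<in> auto (free_group n)"
proof -
  let ?F = "free_group n" and ?s = "artin_auto n i"
  interpret group ?F by (rule group_free_group)
  define g where "g j = (if j = Suc i then free_gen n i
    else if j = i then free_gen n i \<otimes>\<^bsub>?F\<^esub> free_gen n (Suc i) \<otimes>\<^bsub>?F\<^esub> inv\<^bsub>?F\<^esub> free_gen n i
    else free_gen n j)" for j
  let ?t = "gen_lift ?F g"
  have gc: "g \<in> {1..n} \<rightarrow> carrier ?F"
    using i by (auto simp: g_def intro!: free_gen_closed m_closed inv_closed)
  have t: "?t \<in> hom ?F ?F"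
    using gen_lift_hom[OF gc, of "{}"] by (simp add: free_group_def)
  have tg: "?t (free_gen n j) = g j" if "j \<in> {1..n}" for j
    unfolding free_gen_def by (rule gen_lift_gen[OF gc]) (use that in auto)
  have s: "?s \<in> hom ?F ?F" by (rule artin_auto_hom[OF i])
  interpret s: group_hom ?F ?F ?s by unfold_locales (rule s)
  interpret t: group_hom ?F ?F ?t by unfold_locales (rule t)
  have mem: "free_gen n i \<in> carrier ?F" "free_gen n (Suc i) \<in> carrier ?F"
    using i by (auto intro!: free_gen_closed)
  have id: "(\<lambda>x. x) \<in> hom ?F ?F" by (auto simp: hom_def)
  have st: "?s (?t X) = X" if "X \<in> carrier ?F" for X
  proof -
    have "(?s \<circ> ?t) \<in> hom ?F ?F" using Group.hom_compose[OF t s] .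
    then have "(?s \<circ> ?t) X = (\<lambda>x. x) X"
    proof (rule free_group_hom_eq[OF _ id _ that])
      fix j assume j: "j \<in> {1..n}"
      show "(?s \<circ> ?t) (free_gen n j) = free_gen n j"
        using i j mem artin_auto_free_gen[OF i]
        by (auto simp: tg g_def artin_image_def m_assoc inv_cancel_left free_gen_closed)
    qed
    then show ?thesis by simp
  qed
  have ts: "?t (?s X) = X" if "X \<in> carrier ?F" for X
  proof -
    have "(?t \<circ> ?s) \<in> hom ?F ?F" using Group.hom_compose[OF s t] .
    then have "(?t \<circ> ?s) X = (\<lambda>x. x) X"
    proof (rule free_group_hom_eq[OF _ id _ that])
      fix j assume j: "j \<in> {1..n}"
      show "(?t \<circ> ?s) (free_gen n j) = free_gen n j"
        using i j mem artin_auto_free_gen[OF i]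
        by (auto simp: tg g_def artin_image_def m_assoc inv_cancel_left free_gen_closed)
    qed
    then show ?thesis by simp
  qed
  have "bij_betw ?s (carrier ?F) (carrier ?F)"
    by (rule bij_betw_byWitness[where f' = ?t]) (use st ts in auto)
  then show ?thesis
    using s by (auto simp: auto_def Bij_def artin_auto_def)
qed

lemma AutoGroup_mult:
  assumes "g \<in> auto G" "f \<in> auto G"
  shows "g \<otimes>\<^bsub>AutoGroup G\<^esub> f = compose (carrier G) g f"
  using assms by (auto simp: AutoGroup_def BijGroup_def auto_def)

lemma AutoGroup_one: "\<one>\<^bsub>AutoGroup G\<^esub> = restrict (\<lambda>x. x) (carrier G)"
  by (simp add: AutoGroup_def BijGroup_def)

lemma carrier_AutoGroup: "carrier (AutoGroup G) = auto G"
  by (simp add: AutoGroup_def)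

lemma auto_free_group_eqI:
  assumes h: "h \<in> auto (free_group n)" and k: "k \<in> auto (free_group n)"
    and "\<And>j. j \<in> {1..n} \<Longrightarrow> h (free_gen n j) = k (free_gen n j)"
  shows "h = k"
proof (rule extensionalityI[where A = "carrier (free_group n)"])
  show "h \<in> extensional (carrier (free_group n))" "k \<in> extensional (carrier (free_group n))"
    using h k by (auto simp: auto_def Bij_def)
  show "h x = k x" if "x \<in> carrier (free_group n)" for x
    by (rule free_group_hom_eq[of h n k]) (use assms that in \<open>auto simp: auto_def\<close>)
qed

lemma artin_auto_braid_relations:
  assumes "(r, s) \<in> braid_relations n"
  shows "word_eval (AutoGroup (free_group n)) (artin_auto n) r =
         word_eval (AutoGroup (free_group n)) (artin_auto n) s"
proof -
  let ?F = "free_group n" and ?A = "AutoGroup (free_group n)" and ?s = "artin_auto n"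
  interpret F: group ?F by (rule group_free_group)
  interpret A: group ?A by (rule F.AutoGroup)
  have sA: "?s i \<in> carrier ?A" if "i \<in> {1..<n}" for i
    using artin_auto_in_auto[OF that] by (simp add: carrier_AutoGroup)
  have mult: "(g \<otimes>\<^bsub>?A\<^esub> f) x = g (f x)" if "g \<in> carrier ?A" "f \<in> carrier ?A" "x \<in> carrier ?F" for g f x
    using that by (simp add: AutoGroup_mult carrier_AutoGroup compose_eq)
  have closed: "?s i x \<in> carrier ?F" if "i \<in> {1..<n}" "x \<in> carrier ?F" for i x
    using artin_auto_hom[OF that(1)] that(2) by (rule hom_in_carrier)
  have hom_mult: "?s i (x \<otimes>\<^bsub>?F\<^esub> y) = ?s i x \<otimes>\<^bsub>?F\<^esub> ?s i y"
    if "i \<in> {1..<n}" "x \<in> carrier ?F" "y \<in> carrier ?F" for i x y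
    using artin_auto_hom[OF that(1)] that(2,3) by (rule hom_mult)
  have hom_inv: "?s i (inv\<^bsub>?F\<^esub> x) = inv\<^bsub>?F\<^esub> ?s i x" if "i \<in> {1..<n}" "x \<in> carrier ?F" for i x
  proof -
    interpret s: group_hom ?F ?F "?s i" by unfold_locales (rule artin_auto_hom[OF that(1)])
    show ?thesis using that by simp
  qed
  consider
      i j where "r = [(i, True), (j, True)]" "s = [(j, True), (i, True)]"
        "i \<in> {1..<n}" "j \<in> {1..<n}" "i + 2 \<le> j"
    | i where "r = [(i, True), (Suc i, True), (i, True)]" "s = [(Suc i, True), (i, True), (Suc i, True)]"
        "i \<in> {1..<n}" "Suc i \<in> {1..<n}"
    using assms unfolding braid_relations_def by blast
  then show ?thesis
  proof cases
    case 1
    have "?s i \<otimes>\<^bsub>?A\<^esub> ?s j = ?s j \<otimes>\<^bsub>?A\<^esub> ?s i"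
    proof (rule auto_free_group_eqI)
      show "?s i \<otimes>\<^bsub>?A\<^esub> ?s j \<in> auto ?F" "?s j \<otimes>\<^bsub>?A\<^esub> ?s i \<in> auto ?F"
        using sA 1 A.m_closed by (auto simp: carrier_AutoGroup)
      fix k assume k: "k \<in> {1..n}"
      show "(?s i \<otimes>\<^bsub>?A\<^esub> ?s j) (free_gen n k) = (?s j \<otimes>\<^bsub>?A\<^esub> ?s i) (free_gen n k)"
        using 1 k by (auto simp: mult sA free_gen_closed artin_auto_free_gen artin_image_def
            hom_mult hom_inv)
    qed
    then show ?thesis using 1 sA by simp
  next
    case 2
    have "?s i \<otimes>\<^bsub>?A\<^esub> (?s (Suc i) \<otimes>\<^bsub>?A\<^esub> ?s i) = ?s (Suc i) \<otimes>\<^bsub>?A\<^esub> (?s i \<otimes>\<^bsub>?A\<^esub> ?s (Suc i))"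
    proof (rule auto_free_group_eqI)
      show "?s i \<otimes>\<^bsub>?A\<^esub> (?s (Suc i) \<otimes>\<^bsub>?A\<^esub> ?s i) \<in> auto ?F"
        "?s (Suc i) \<otimes>\<^bsub>?A\<^esub> (?s i \<otimes>\<^bsub>?A\<^esub> ?s (Suc i)) \<in> auto ?F"
        using sA[OF 2(3)] sA[OF 2(4)] A.m_closed by (auto simp: carrier_AutoGroup)
      fix k assume k: "k \<in> {1..n}"
      have mem: "free_gen n i \<in> carrier ?F" "free_gen n (Suc i) \<in> carrier ?F"
        "free_gen n (Suc (Suc i)) \<in> carrier ?F"
        using 2 by (auto intro!: free_gen_closed)
      show "(?s i \<otimes>\<^bsub>?A\<^esub> (?s (Suc i) \<otimes>\<^bsub>?A\<^esub> ?s i)) (free_gen n k) =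
            (?s (Suc i) \<otimes>\<^bsub>?A\<^esub> (?s i \<otimes>\<^bsub>?A\<^esub> ?s (Suc i))) (free_gen n k)"
        using 2 k mem by (auto simp: mult sA free_gen_closed artin_auto_free_gen artin_image_def
            hom_mult hom_inv F.m_assoc F.inv_mult_group F.inv_cancel_left)
    qed
    then show ?thesis using 2 sA by simp
  qed
qed

theorem braid_action_hom: "braid_action n \<in> hom (braid_group n) (AutoGroup (free_group n))"
  unfolding braid_action_def braid_group_def
  by (rule group.gen_lift_hom[OF group.AutoGroup[OF group_free_group]])
     (auto simp: carrier_AutoGroup intro!: artin_auto_in_auto artin_auto_braid_relations)

theorem braid_action_braid_gen:
  "i \<in> {1..<n} \<Longrightarrow> braid_action n (braid_gen n i) = artin_auto n i"
  unfolding braid_action_def braid_gen_def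
  by (rule group.gen_lift_gen[OF group.AutoGroup[OF group_free_group]])
     (auto simp: carrier_AutoGroup intro!: artin_auto_in_auto artin_auto_braid_relations)

end

theory Submission
  imports Defs
begin

text \<open>Given a cone \<open>P\<close> preserved by \<open>\<beta>\<close>, order \<open>F\<^sub>n\<close> lexicographically: first by exponent sum, then,
  on the kernel of the exponent sum, by \<open>P\<close>. The result is again a conjugation-invariant cone because
  the exponent sum is a homomorphism to an abelian group, and \<open>\<beta>\<close> preserves it because each Artin
  generator maps every \<open>x\<^sub>j\<close> to a conjugate of a generator and hence preserves exponent sums.\<close>

definition lex_cone :: "('a, 'b) monoid_scheme \<Rightarrow> ('a \<Rightarrow> int) \<Rightarrow> 'a set \<Rightarrow> 'a set" where
  "lex_cone G t P = {g \<in> carrier G. t g > 0} \<union> {g \<in> P. t g = 0}"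

text \<open>Trades the set-level axioms (set products, set inverses, cosets) for elementwise
  conditions that can be checked one at a time for the lexicographic cone.\<close>

lemma (in group) positive_cone_iff:
  "positive_cone G P \<longleftrightarrow>
     P \<subseteq> carrier G \<and> \<one> \<notin> P \<and>
     (\<forall>x\<in>P. \<forall>y\<in>P. x \<otimes> y \<in> P) \<and>
     (\<forall>x\<in>carrier G. x = \<one> \<or> x \<in> P \<or> inv x \<in> P) \<and>
     (\<forall>x\<in>P. inv x \<notin> P) \<and>
     (\<forall>g\<in>carrier G. \<forall>x\<in>P. g \<otimes> x \<otimes> inv g \<in> P)"
proof (cases "P \<subseteq> carrier G")
  case True
  have set_inv: "x \<in> set_inv P \<longleftrightarrow> x \<in> carrier G \<and> inv x \<in> P" for x
    using True by (force simp: SET_INV_def)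
  have conj: "(g <# P) #> inv g = (\<lambda>x. g \<otimes> x \<otimes> inv g) ` P" for g
    by (auto simp: l_coset_def r_coset_def)
  have mult: "P <#> P \<subseteq> P \<longleftrightarrow> (\<forall>x\<in>P. \<forall>y\<in>P. x \<otimes> y \<in> P)"
    by (auto simp: set_mult_def)
  \<comment> \<open>This inclusion is automatic, so the decomposition of the carrier reduces to the
    covering direction.\<close>
  have "P \<union> set_inv P \<union> {\<one>} \<subseteq> carrier G"
    using True by (simp add: subset_iff set_inv)
  then have "carrier G = P \<union> set_inv P \<union> {\<one>} \<longleftrightarrow> carrier G \<subseteq> P \<union> set_inv P \<union> {\<one>}"
    by blast
  also have "\<dots> \<longleftrightarrow> (\<forall>x\<in>carrier G. x = \<one> \<or> x \<in> P \<or> inv x \<in> P)"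
    unfolding subset_iff Un_iff singleton_iff set_inv by blast
  finally have cover: "carrier G = P \<union> set_inv P \<union> {\<one>} \<longleftrightarrow>
      (\<forall>x\<in>carrier G. x = \<one> \<or> x \<in> P \<or> inv x \<in> P)" .
  have disj: "P \<inter> set_inv P = {} \<longleftrightarrow> (\<forall>x\<in>P. inv x \<notin> P)"
    using True unfolding disjoint_iff set_inv by blast
  have conj_iff: "(\<forall>g\<in>carrier G. (\<lambda>x. g \<otimes> x \<otimes> inv g) ` P = P) \<longleftrightarrow>
      (\<forall>g\<in>carrier G. \<forall>x\<in>P. g \<otimes> x \<otimes> inv g \<in> P)"
  proof
    assume R: "\<forall>g\<in>carrier G. \<forall>x\<in>P. g \<otimes> x \<otimes> inv g \<in> P"
    \<comment> \<open>Invariance under conjugation by \<open>inv g\<close> supplies the preimage, so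
      inclusions for all \<open>g\<close> already force equalities.\<close>
    have "x \<in> (\<lambda>x. g \<otimes> x \<otimes> inv g) ` P" if "g \<in> carrier G" "x \<in> P" for g x
    proof (rule image_eqI)
      show "inv g \<otimes> x \<otimes> g \<in> P" using R[rule_format, of "inv g" x] that by simp
      show "x = g \<otimes> (inv g \<otimes> x \<otimes> g) \<otimes> inv g"
        using that True by (simp add: m_assoc inv_cancel_left subset_iff)
    qed
    with R show "\<forall>g\<in>carrier G. (\<lambda>x. g \<otimes> x \<otimes> inv g) ` P = P" by blast
  qed blast
  show ?thesis
    unfolding positive_cone_def conj mult cover disj conj_iff set_inv inv_one using True by blast
qed (simp add: positive_cone_def)

text \<open>Off the kernel of \<open>t\<close> the sign of \<open>t x\<close> decides every
  condition; on the kernel each one is inherited from \<open>P\<close>. This works for any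
  homomorphism \<open>t\<close> to the integers.\<close>

lemma positive_cone_lex_cone:
  assumes G: "group G" and t: "t \<in> hom G integer_group" and P: "positive_cone G P"
  shows "positive_cone G (lex_cone G t P)"
proof -
  interpret t: group_hom G integer_group t
    using G t by (simp add: group_hom_def group_hom_axioms_def)
  have [simp]: "t (x \<otimes>\<^bsub>G\<^esub> y) = t x + t y" if "x \<in> carrier G" "y \<in> carrier G" for x y
    using t.hom_mult that by simp
  have [simp]: "t (inv\<^bsub>G\<^esub> x) = - t x" if "x \<in> carrier G" for x
    using t.hom_inv that by simp
  have [simp]: "t \<one>\<^bsub>G\<^esub> = 0"
    using t.hom_one by simp
  from P have P': "P \<subseteq> carrier G" "\<one>\<^bsub>G\<^esub> \<notin> P"
    "\<forall>x\<in>P. \<forall>y\<in>P. x \<otimes>\<^bsub>G\<^esub> y \<in> P"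
    "\<forall>x\<in>carrier G. x = \<one>\<^bsub>G\<^esub> \<or> x \<in> P \<or> inv\<^bsub>G\<^esub> x \<in> P"
    "\<forall>x\<in>P. inv\<^bsub>G\<^esub> x \<notin> P"
    "\<forall>g\<in>carrier G. \<forall>x\<in>P. g \<otimes>\<^bsub>G\<^esub> x \<otimes>\<^bsub>G\<^esub> inv\<^bsub>G\<^esub> g \<in> P"
    unfolding t.G.positive_cone_iff by blast+
  have mem: "x \<in> lex_cone G t P \<longleftrightarrow> x \<in> carrier G \<and> (t x > 0 \<or> t x = 0 \<and> x \<in> P)" for x
    using P'(1) by (auto simp: lex_cone_def)
  show ?thesis
    unfolding t.G.positive_cone_iff
  proof (intro conjI ballI)
    show "x = \<one>\<^bsub>G\<^esub> \<or> x \<in> lex_cone G t P \<or> inv\<^bsub>G\<^esub> x \<in> lex_cone G t P" if "x \<in> carrier G" for x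
      using that P'(4) by (cases "t x" "0 :: int" rule: linorder_cases) (auto simp: mem)
    show "\<one>\<^bsub>G\<^esub> \<notin> lex_cone G t P" using P'(2) by (simp add: mem)
    show "lex_cone G t P \<subseteq> carrier G" using mem by blast
    show "x \<otimes>\<^bsub>G\<^esub> y \<in> lex_cone G t P" if "x \<in> lex_cone G t P" "y \<in> lex_cone G t P" for x y
      using that P'(3) by (auto simp: mem)
    show "inv\<^bsub>G\<^esub> x \<notin> lex_cone G t P" if "x \<in> lex_cone G t P" for x
      using that P'(5) by (auto simp: mem)
    show "g \<otimes>\<^bsub>G\<^esub> x \<otimes>\<^bsub>G\<^esub> inv\<^bsub>G\<^esub> g \<in> lex_cone G t P" if "g \<in> carrier G" "x \<in> lex_cone G t P" for g x
      using that P'(6) by (auto simp: mem)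
  qed
qed

text \<open>A bijection that fixes \<open>P\<close> setwise and preserves the value of
  \<open>t\<close> permutes each level set of \<open>t\<close>, both in the whole group and inside
  \<open>P\<close>, hence both pieces of the cone.\<close>

lemma image_lex_cone:
  assumes f: "bij_betw f (carrier G) (carrier G)"
    and t: "\<And>x. x \<in> carrier G \<Longrightarrow> t (f x) = t x"
    and P: "P \<subseteq> carrier G" "f ` P = P"
  shows "f ` lex_cone G t P = lex_cone G t P"
proof -
  have "f ` {x \<in> A. Q (t x)} = {x \<in> A. Q (t x)}" if "A \<subseteq> carrier G" "f ` A = A" for A Q
  proof -
    have "f ` {x \<in> A. Q (t x)} = {y \<in> f ` A. Q (t y)}"
      using that(1) t by force
    with that(2) show ?thesis by simp
  qed
  note this[of "carrier G" "\<lambda>k. k > 0"] this[of P "\<lambda>k. k = 0"]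
  with f P show ?thesis
    by (simp add: lex_cone_def image_Un bij_betw_imp_surj_on)
qed

text \<open>Both sides are homomorphisms to the integers, so comparing them on the free generators
  suffices; there conjugation cancels in the abelian target.\<close>

lemma exponent_sum_artin_auto:
  assumes i: "i \<in> {1..<n}" and x: "x \<in> carrier (free_group n)"
  shows "exponent_sum (artin_auto n i x) = exponent_sum x"
proof -
  let ?F = "free_group n"
  interpret e: group_hom ?F integer_group exponent_sum
    using group_free_group exponent_sum_hom by (simp add: group_hom_def group_hom_axioms_def)
  have "(exponent_sum \<circ> artin_auto n i) x = exponent_sum x"
  proof (rule hom_eq_on_gens[of integer_group _ "{1..n}" "{}"])
    show "exponent_sum \<circ> artin_auto n i \<in> hom (presented_group {1..n} {}) integer_group"
      using Group.hom_compose[OF artin_auto_hom[OF i] exponent_sum_hom] by (simp add: free_group_def)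
    fix j assume j: "j \<in> {1..n}"
    have "exponent_sum (artin_auto n i (free_gen n j)) = exponent_sum (free_gen n j)"
      using i j by (auto simp: artin_auto_free_gen artin_image_def exponent_sum_free_gen free_gen_closed)
    then show "(exponent_sum \<circ> artin_auto n i) (word_class {1..n} {} [(j, True)]) =
        exponent_sum (word_class {1..n} {} [(j, True)])"
      by (simp add: free_gen_def)
  qed (use x exponent_sum_hom in \<open>auto simp: free_group_def\<close>)
  then show ?thesis by simp
qed

text \<open>Invariance passes from the Artin generators to their inverses, and then to all braid
  words by induction on length.\<close>

lemma exponent_sum_braid_action:
  assumes \<beta>: "\<beta> \<in> carrier (braid_group n)" and x: "x \<in> carrier (free_group n)"
  shows "exponent_sum (braid_action n \<beta> x) = exponent_sum x"
proof -
  let ?F = "free_group n" and ?A = "AutoGroup (free_group n)" and ?s = "artin_auto n"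
  interpret A: group ?A by (rule group.AutoGroup[OF group_free_group])
  have closed: "f y \<in> carrier ?F" if "f \<in> carrier ?A" "y \<in> carrier ?F" for f y
    using that by (auto simp: carrier_AutoGroup auto_def intro: hom_in_carrier)
  have mult: "(g \<otimes>\<^bsub>?A\<^esub> f) y = g (f y)"
    if "g \<in> carrier ?A" "f \<in> carrier ?A" "y \<in> carrier ?F" for g f y
    using that by (simp add: AutoGroup_mult carrier_AutoGroup compose_eq)
  have s: "?s \<in> {1..<n} \<rightarrow> carrier ?A"
    by (auto simp: carrier_AutoGroup intro: artin_auto_in_auto)
  \<comment> \<open>No formula for the inverse automorphism is needed: invariance under
    \<open>?s i\<close> is applied at the preimage of \<open>y\<close>.\<close>
  have inv: "exponent_sum ((inv\<^bsub>?A\<^esub> ?s i) y) = exponent_sum y"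
    if i: "i \<in> {1..<n}" and y: "y \<in> carrier ?F" for i y
  proof -
    have si: "?s i \<in> carrier ?A" using s i by blast
    have "?s i ((inv\<^bsub>?A\<^esub> ?s i) y) = y"
      using mult[OF si A.inv_closed[OF si] y] y by (simp add: A.r_inv[OF si] AutoGroup_one)
    then show ?thesis
      using exponent_sum_artin_auto[OF i closed[OF A.inv_closed[OF si] y]] by simp
  qed
  have eval: "exponent_sum (word_eval ?A ?s w y) = exponent_sum y"
    if "w \<in> words {1..<n}" "y \<in> carrier ?F" for w y
    using that(1)
  proof (induction w)
    case Nil
    then show ?case using that by (simp add: AutoGroup_one)
  next
    case (Cons l w)
    have w: "word_eval ?A ?s w \<in> carrier ?A" and l: "fst l \<in> {1..<n}"
      using A.word_eval_closed[OF s] Cons.hyps by auto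
    have sl: "?s (fst l) \<in> carrier ?A" using s l by blast
    \<comment> \<open>The head letter acts last, so its invariance is used at the point
      \<open>word_eval ?A ?s w y\<close>; the sign of the letter selects
      \<open>exponent_sum_artin_auto\<close> or \<open>inv\<close>.\<close>
    show ?case
      using Cons.IH mult w sl that(2) closed[OF w that(2)] inv[OF l] exponent_sum_artin_auto[OF l]
      by simp
  qed
  obtain w where w: "w \<in> words {1..<n}" "\<beta> = word_class {1..<n} (braid_relations n) w"
    using \<beta> unfolding braid_group_def by (rule presented_group_cases)
  \<comment> \<open>The Artin automorphisms satisfy the braid relations, so any representative word
    computes the action.\<close>
  have "braid_action n \<beta> = word_eval ?A ?s w"
    unfolding braid_action_def w(2)
    by (rule A.gen_lift_word_class[OF s _ w(1)]) (auto intro!: artin_auto_braid_relations)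
  with eval[OF w(1) x] show ?thesis by simp
qed

theorem theorem5:
  fixes n :: nat and \<beta> :: "nat word set"
  assumes "\<beta> \<in> carrier (braid_group n)"
  shows "order_preserving n \<beta> \<longleftrightarrow>
    (\<exists>P. positive_cone (free_group n) P \<and> braid_action n \<beta> ` P = P \<and>
      (\<forall>g\<in>carrier (free_group n). exponent_sum g > 0 \<longrightarrow> g \<in> P))"
proof
  let ?F = "free_group n"
  assume "order_preserving n \<beta>"
  then obtain P where P: "positive_cone ?F P" "braid_action n \<beta> ` P = P"
    unfolding order_preserving_def by blast
  \<comment> \<open>Membership in \<open>auto\<close> provides the bijectivity that makes the set of
    elements of positive exponent sum map onto itself.\<close>
  have "braid_action n \<beta> \<in> auto ?F"
    using hom_in_carrier[OF braid_action_hom assms] by (simp add: carrier_AutoGroup)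
  then have "bij_betw (braid_action n \<beta>) (carrier ?F) (carrier ?F)"
    by (simp add: auto_def Bij_def)
  then have "braid_action n \<beta> ` lex_cone ?F exponent_sum P = lex_cone ?F exponent_sum P"
    using P exponent_sum_braid_action[OF assms]
    by (intro image_lex_cone) (auto simp: positive_cone_def)
  moreover have "positive_cone ?F (lex_cone ?F exponent_sum P)"
    by (rule positive_cone_lex_cone[OF group_free_group exponent_sum_hom P(1)])
  ultimately show "\<exists>P. positive_cone ?F P \<and> braid_action n \<beta> ` P = P \<and>
      (\<forall>g\<in>carrier ?F. exponent_sum g > 0 \<longrightarrow> g \<in> P)"
    by (intro exI[of _ "lex_cone ?F exponent_sum P"]) (auto simp: lex_cone_def)
qed (auto simp: order_preserving_def)

end
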